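(* Let $D,E,G,H,J$ be complex numbers and put $A=-D+E+G+H-3$, $B=12D+12G-4J-12$, $C=-E-2G-H+4$, $F=-2D-2G-2H+6$, $I=4D-E+2G-H-J$, and assume $I\ne0$. Then for all integers $m\ge0$ and $n\ge1$, $$\begin{aligned} I\,t_{2,m}^{(n)}&=\frac1{(A_1^{(n)})^4}\sum_{k_1+k_2+k_3+k_4=m}\binom{m}{k_1,k_2,k_3,k_4}U_{k_1}^{(n)}U_{k_2}^{(n)}U_{k_3}^{(n)}U_{k_4}^{(n)}\\ &\quad-\frac{A}{A_1^{(4n)}}4^mU_m^{(4n)}-B\left(\frac{-1}{563}\right)^n-\frac{C}{A_1^{(3n)}A_1^{(n)}}\sum_{k=0}^m\binom mk3^{m-k}U_{m-k}^{(3n)}U_k^{(n)}\\ &\quad-\frac{D}{(A_1^{(2n)})^2}\sum_{k=0}^m\binom mk2^mU_k^{(2n)}U_{m-k}^{(2n)}-\frac{E}{A_1^{(2n)}}\sum_{k=0}^m\binom mk2^{m-k}U_{m-k}^{(2n)}t_{1,k}^{(n)}\\ &\quad-F\sum_{k=0}^m\binom mkt_{1,k}^{(n)}t_{1,m-k}^{(n)}-\frac{G}{A_1^{(2n)}(A_1^{(n)})^2}\sum_{k_1+k_2+k_3=m}\binom{m}{k_1,k_2,k_3}2^{k_1}U_{k_1}^{(2n)}U_{k_2}^{(n)}U_{k_3}^{(n)}\\ &\quad-\frac{H}{(A_1^{(n)})^2}\sum_{k_1+k_2+k_3=m}\binom{m}{k_1,k_2,k_3}t_{1,k_1}^{(n)}U_{k_2}^{(n)}U_{k_3}^{(n)}\\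 &\quad-\frac{J}{A_2^{(n)}A_1^{(n)}}\sum_{k_1+k_2+k_3=m}\binom{m}{k_1,k_2,k_3}(-1)^{k_1}V_{k_1}^{(n)}U_{k_2}^{(n)}. \end{aligned}$$
   Context: Let $\lambda_1,\lambda_2,\lambda_3,\lambda_4$ be the (distinct, complex) roots of $x^4-x^3-x^2-x-1=0$ and $c_i=\frac1{-\lambda_i^3+6\lambda_i-1}$. A Tetranacci-type sequence is one in which, from index $4$ on, each term is the sum of the four preceding terms. For each $n\ge1$, let $A_1^{(n)}$ be the nonzero rational number and $U_k^{(n)}=T_{1,k}^{(s_{1,0}^{(n)},s_{1,1}^{(n)},s_{1,2}^{(n)},s_{1,3}^{(n)})}$ the Tetranacci-type sequence with integer initial values $U_j^{(n)}=s_{1,j}^{(n)}$ ($0\le j\le3$) of greatest common divisor $1$ such that $$\sum_{i=1}^4c_i^ne^{\lambda_ix}=\frac1{A_1^{(n)}}\sum_{k=0}^\infty U_k^{(n)}\frac{x^k}{k!}.$$ Likewise let $A_2^{(n)}$ be the nonzero rational number and $V_k^{(n)}=T_{2,k}^{(s_{2,0}^{(n)},s_{2,1}^{(n)},s_{2,2}^{(n)},s_{2,3}^{(n)})}$ the Tetranacci-type sequence with integer initial values $V_j^{(n)}=s_{2,j}^{(n)}$ ($0\le j\le3$) of greatest common divisor $1$ such that $$\sum_{i=1}^4\Big(\prod_{j\ne i}c_j^n\Big)e^{\lambda_ix}=\frac1{A_2^{(n)}}\sum_{k=0}^\infty V_k^{(n)}\frac{x^k}{k!}.$$ The signs are fixed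 by requiring $U_k^{(n)}>0$ and $V_k^{(n)}>0$ for all sufficiently large $k$. Put $$t_{1,m}^{(n)}=\frac12\left(\frac1{(A_1^{(n)})^2}\sum_{k=0}^m\binom mkU_k^{(n)}U_{m-k}^{(n)}-\frac{2^m}{A_1^{(2n)}}U_m^{(2n)}\right),$$ equivalently $\sum_{m\ge0}t_{1,m}^{(n)}\frac{x^m}{m!}=\sum_{1\le i<j\le4}c_i^nc_j^ne^{(\lambda_i+\lambda_j)x}$, and define $t_{2,m}^{(n)}$ by $$\sum_{m=0}^\infty t_{2,m}^{(n)}\frac{x^m}{m!}=\sum_{1\le i<j<l\le4}c_i^nc_j^nc_l^ne^{(\lambda_i+\lambda_j+\lambda_l)x}\left(c_i^ne^{\lambda_ix}+c_j^ne^{\lambda_jx}+c_l^ne^{\lambda_lx}\right).$$ Superscripts $(n)$ are indices; $c_i^n$ is an $n$-th power. All indices $k_i$ run over nonnegative integers and $\binom{m}{k_1,\dots,k_r}=\frac{m!}{k_1!\cdots k_r!}$. *)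

theory Defs
  imports Complex_Main "HOL-Computational_Algebra.Formal_Power_Series"
begin

text \<open>\<open>lam 1, \<dots>, lam 4\<close> enumerates the roots of \<open>x^4 - x^3 - x^2 - x - 1\<close>;
  injectivity of the enumeration says that the roots are distinct.\<close>

definition tetranacci_roots :: "(nat \<Rightarrow> complex) \<Rightarrow> bool" where
  "tetranacci_roots lam \<longleftrightarrow>
     bij_betw lam {1..4} {x. x ^ 4 - x ^ 3 - x ^ 2 - x - 1 = 0}"

definition root_coeff :: "(nat \<Rightarrow> complex) \<Rightarrow> nat \<Rightarrow> complex" where
  "root_coeff lam i = 1 / (- (lam i ^ 3) + 6 * lam i - 1)"

definition tetranacci_type :: "(nat \<Rightarrow> int) \<Rightarrow> bool" where
  "tetranacci_type s \<longleftrightarrow> (\<forall>k\<ge>4. s k = s (k - 1) + s (k - 2) + s (k - 3) + s (k - 4))"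

definition egf :: "(nat \<Rightarrow> complex) \<Rightarrow> complex fps" where
  "egf a = Abs_fps (\<lambda>k. a k / fact k)"

text \<open>The normal form \<open>f(x) = (1/a) \<Sum>\<^sub>k s\<^sub>k x^k / k!\<close>. The coprimality of the initial values
  determines \<open>(a, s)\<close> up to a common sign, which eventual positivity fixes.\<close>

definition tetranacci_normal_form :: "complex fps \<Rightarrow> rat \<Rightarrow> (nat \<Rightarrow> int) \<Rightarrow> bool" where
  "tetranacci_normal_form f a s \<longleftrightarrow>
     a \<noteq> 0 \<and> tetranacci_type s \<and> Gcd {s 0, s 1, s 2, s 3} = 1 \<and>
     (\<forall>\<^sub>F k in sequentially. s k > 0) \<and>
     f = fps_const (1 / of_rat a) * egf (\<lambda>k. of_int (s k))"

text \<open>In the library, \<open>fps_exp a\<close> is the power series of \<open>e^(a x)\<close>.\<close>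

definition power_gf :: "(nat \<Rightarrow> complex) \<Rightarrow> nat \<Rightarrow> complex fps" where
  "power_gf lam n = (\<Sum>i=1..4. fps_const (root_coeff lam i ^ n) * fps_exp (lam i))"

definition coproduct_gf :: "(nat \<Rightarrow> complex) \<Rightarrow> nat \<Rightarrow> complex fps" where
  "coproduct_gf lam n =
     (\<Sum>i=1..4. fps_const (\<Prod>j\<in>{1..4} - {i}. root_coeff lam j ^ n) * fps_exp (lam i))"

definition t1 :: "(nat \<Rightarrow> rat) \<Rightarrow> (nat \<Rightarrow> nat \<Rightarrow> int) \<Rightarrow> nat \<Rightarrow> nat \<Rightarrow> complex" where
  "t1 A1 U n m =
     1 / 2 * (1 / of_rat (A1 n) ^ 2 *
                (\<Sum>k=0..m. of_nat (m choose k) * of_int (U n k) * of_int (U n (m - k)))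
              - 2 ^ m / of_rat (A1 (2 * n)) * of_int (U (2 * n) m))"

definition t2_gf :: "(nat \<Rightarrow> complex) \<Rightarrow> nat \<Rightarrow> complex fps" where
  "t2_gf lam n =
     (\<Sum>(i, j, l) \<in> {(i, j, l). 1 \<le> i \<and> i < j \<and> j < l \<and> l \<le> 4}.
        fps_const (root_coeff lam i ^ n * root_coeff lam j ^ n * root_coeff lam l ^ n) *
        fps_exp (lam i + lam j + lam l) *
        (fps_const (root_coeff lam i ^ n) * fps_exp (lam i) +
         fps_const (root_coeff lam j ^ n) * fps_exp (lam j) +
         fps_const (root_coeff lam l ^ n) * fps_exp (lam l)))"

definition t2 :: "(nat \<Rightarrow> complex) \<Rightarrow> nat \<Rightarrow> nat \<Rightarrow> complex" where
  "t2 lam n m = fact m * fps_nth (t2_gf lam n) m"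

lemma egf_t2: "egf (t2 lam n) = t2_gf lam n"
  by (simp add: egf_def t2_def fps_eq_iff)

definition multinom :: "nat \<Rightarrow> nat list \<Rightarrow> complex" where
  "multinom m ks = fact m / (\<Prod>k\<leftarrow>ks. fact k)"

end

theory Submission
  imports Defs
begin

text \<open>
  Put \<open>a\<^sub>i = c\<^sub>i^n e^(\<lambda>\<^sub>i x)\<close>. Every sequence in the identity has an exponential generating function
  that is a symmetric polynomial in \<open>a\<^sub>1, \<dots>, a\<^sub>4\<close>, and a multinomial convolution of sequences is a
  product of their generating functions. So the identity compares the coefficients of \<open>x^m / m!\<close> in
  an identity between symmetric polynomials of degree four.

  The dictionary is as follows. The normal form of index \<open>r n\<close>, with \<open>x\<close> replaced by \<open>r x\<close>, gives the
  power sum \<open>p\<^sub>r\<close> of the \<open>a\<^sub>i\<close> (\<open>power_sum_eq_egf\<close>), and \<open>t\<^sub>1\<close> gives \<open>e\<^sub>2 = (p\<^sub>1\<^sup>2 - p\<^sub>2) / 2\<close>.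
  Two facts about the roots are special to this quartic. Their sum is \<open>1\<close>, so that \<open>e\<^sub>3\<close> is \<open>e^x\<close> times
  the coproduct series at \<open>- x\<close> (\<open>triple_products_eq_egf\<close>); the factor \<open>e^x\<close> is the reason why the
  index \<open>k\<^sub>3\<close> of the last sum carries no sequence. Moreover \<open>c\<^sub>1 c\<^sub>2 c\<^sub>3 c\<^sub>4 = - 1 / 563\<close>, so that
  \<open>e\<^sub>4 = (- 1 / 563)^n e^x\<close>, all of whose coefficients of \<open>x^m / m!\<close> are equal (\<open>prod_exp_terms\<close>).

  Finally \<open>t\<^sub>2\<close> gives the monomial symmetric function \<open>m\<^sub>2\<^sub>1\<^sub>1\<close>. Expanding \<open>p\<^sub>1\<^sup>4\<close> and the products that
  accompany \<open>A, \<dots>, J\<close> in the basis \<open>m\<^sub>4, m\<^sub>3\<^sub>1, m\<^sub>2\<^sub>2, m\<^sub>2\<^sub>1\<^sub>1, m\<^sub>1\<^sub>1\<^sub>1\<^sub>1\<close> yields five linear equations in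
  these constants. They are solved by the given \<open>A\<close>, \<open>B\<close>, \<open>C\<close>, \<open>F\<close>, \<open>I\<close> with \<open>D\<close>, \<open>E\<close>, \<open>G\<close>, \<open>H\<close>, \<open>J\<close>
  free (\<open>quartic_symmetric_identity\<close>).
\<close>

unbundle fps_syntax

section \<open>The roots of the Tetranacci polynomial\<close>

text \<open>
  The divided differences of \<open>x^4 - x^3 - x^2 - x - 1\<close> at two, three and four distinct roots vanish.
  The last one is \<open>a + b + c + d - 1\<close>, and the elementary symmetric functions of higher degree
  follow from the lower ones by means of the earlier differences and of the equation itself.
\<close>

lemma tetranacci_vieta:
  fixes a b c d :: "'a::field"
  assumes ra: "a ^ 4 - a ^ 3 - a ^ 2 - a - 1 = 0" and rb: "b ^ 4 - b ^ 3 - b ^ 2 - b - 1 = 0"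
    and rc: "c ^ 4 - c ^ 3 - c ^ 2 - c - 1 = 0" and rd: "d ^ 4 - d ^ 3 - d ^ 2 - d - 1 = 0"
    and distinct: "a \<noteq> b" "a \<noteq> c" "a \<noteq> d" "b \<noteq> c" "b \<noteq> d" "c \<noteq> d"
  shows "a + b + c + d = 1"
    and "a * b + a * c + a * d + b * c + b * d + c * d = - 1"
    and "a * b * c + a * b * d + a * c * d + b * c * d = 1"
    and "a * b * c * d = - 1"
proof -
  have diff2: "(x^3 + x^2*y + x*y^2 + y^3) - (x^2 + x*y + y^2) - (x + y) - 1 = 0"
    if "x ^ 4 - x ^ 3 - x ^ 2 - x - 1 = 0" "y ^ 4 - y ^ 3 - y ^ 2 - y - 1 = 0" "x \<noteq> y" for x y :: 'a
  proof -
    have "(x - y) * ((x^3 + x^2*y + x*y^2 + y^3) - (x^2 + x*y + y^2) - (x + y) - 1) = 0"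
      using that(1,2) by algebra
    then show ?thesis using that(3) by simp
  qed
  have diff3: "(x^2 + y^2 + z^2 + x*y + x*z + y*z) - (x + y + z) - 1 = 0"
    if "x ^ 4 - x ^ 3 - x ^ 2 - x - 1 = 0" "y ^ 4 - y ^ 3 - y ^ 2 - y - 1 = 0"
      "z ^ 4 - z ^ 3 - z ^ 2 - z - 1 = 0" "x \<noteq> y" "x \<noteq> z" "y \<noteq> z" for x y z :: 'a
  proof -
    have "(y - z) * ((x^2 + y^2 + z^2 + x*y + x*z + y*z) - (x + y + z) - 1) = 0"
      using diff2[OF that(1,2,4)] diff2[OF that(1,3,5)] by algebra
    then show ?thesis using that(6) by simp
  qed
  have "(c - d) * (a + b + c + d - 1) = 0"
    using diff3[OF ra rb rc distinct(1,2,4)] diff3[OF ra rb rd distinct(1,3,5)] by algebra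
  then show e1: "a + b + c + d = 1" using distinct(6) by simp
  show e2: "a * b + a * c + a * d + b * c + b * d + c * d = - 1"
    using diff3[OF ra rb rc distinct(1,2,4)] e1 by algebra
  show e3: "a * b * c + a * b * d + a * c * d + b * c * d = 1"
    using diff2[OF ra rb distinct(1)] e1 e2 by algebra
  show "a * b * c * d = - 1"
    using ra e1 e2 e3 by algebra
qed

text \<open>
  For a root \<open>x\<close>, \<open>x\<^sup>2 (- x\<^sup>3 + 6 x - 1)\<close> is the derivative of the quartic at \<open>x\<close>. Since the roots have
  product \<open>- 1\<close>, the product below is the discriminant of the quartic. For the computation the roots are grouped into two pairs: each half of
  the product is a polynomial in the sum and the product of its pair, and the sum and the product of
  one pair determine those of the other.
\<close>

lemma tetranacci_discriminant:
  fixes a b c d :: "'a::field"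
  assumes e1: "a + b + c + d = 1"
    and e2: "a * b + a * c + a * d + b * c + b * d + c * d = - 1"
    and e3: "a * b * c + a * b * d + a * c * d + b * c * d = 1"
    and e4: "a * b * c * d = - 1"
  shows "(- (a^3) + 6 * a - 1) * (- (b^3) + 6 * b - 1) *
    ((- (c^3) + 6 * c - 1) * (- (d^3) + 6 * d - 1)) = - 563"
proof -
  define s p q where "s = a + b" and "p = a * b" and "q = c * d"
  have cd: "c + d = 1 - s" using e1 unfolding s_def by algebra
  have q: "q = s^2 - s - 1 - p" using e2 e1 unfolding s_def p_def q_def by algebra
  have r1: "p * (1 - s) + q * s = 1"
    using e3 unfolding cd[symmetric] unfolding s_def p_def q_def by algebra
  have r2: "p * q = - 1"
    using e4 unfolding p_def q_def by algebra
  have pair: "(- (x^3) + 6 * x - 1) * (- (y^3) + 6 * y - 1) =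
     (x*y)^3 - 6*(x*y)*((x+y)^2 - 2*(x*y)) + (x+y)^3 - 3*(x+y)*(x*y) + 36*(x*y) - 6*(x+y) + 1" for x y :: 'a
    by algebra
  define t where "t = 1 - s"
  \<comment> \<open>Eliminating the other pair from \<open>r1\<close> and \<open>r2\<close> gives relations between the sum \<open>x\<close> and the
    product \<open>y\<close> of a pair. They reduce each half, of degree six in the roots, to a quadratic
    polynomial in \<open>x\<close> and \<open>y\<close>.\<close>
  have half: "y^3 - 6*y*(x^2 - 2*y) + x^3 - 3*x*y + 36*y - 6*x + 1 = 5*y^2 + 30*y - 8*x*y - 5*x + 8"
    if x3: "x^3 = x^2 + x + 1 - y + 2*x*y" and yx2: "y*x^2 = y*x + y + y^2 - 1"
      and xy2: "x*y^2 = y^2 - x - y" for x y :: 'a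
  proof -
    have "y^3 = y - x^2 - x*y - y^2"
      using yx2 xy2 by algebra
    then show ?thesis using x3 yx2 by algebra
  qed
  have half_ab: "p^3 - 6*p*(s^2 - 2*p) + s^3 - 3*s*p + 36*p - 6*s + 1 = 5*p^2 + 30*p - 8*s*p - 5*s + 8"
  proof (rule half)
    show "s^3 = s^2 + s + 1 - p + 2*s*p" using r1 q by algebra
    show "p*s^2 = p*s + p + p^2 - 1" using r2 q by algebra
    show "s*p^2 = p^2 - s - p" using r1 r2 by algebra
  qed
  have half_cd: "q^3 - 6*q*(t^2 - 2*q) + t^3 - 3*t*q + 36*q - 6*t + 1 = 5*q^2 + 30*q - 8*t*q - 5*t + 8"
  proof (rule half)
    show "t^3 = t^2 + t + 1 - q + 2*t*q" using r1 q t_def by algebra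
    show "q*t^2 = q*t + q + q^2 - 1" using r2 q t_def by algebra
    show "t*q^2 = q^2 - t - q" using r1 r2 t_def by algebra
  qed
  have "(5*p^2 + 30*p - 8*s*p - 5*s + 8) * (5*q^2 + 30*q - 8*t*q - 5*t + 8) = - 563"
  proof -
    have "p + q = - 1 - s*t" using q t_def by algebra
    moreover have "p*t + q*s = 1" using r1 t_def by algebra
    moreover have "p*s + q*t = - 2 - s*t" using q r1 t_def by algebra
    moreover have "s + t = 1" using t_def by algebra
    \<comment> \<open>the resolvent cubic, which \<open>s*t = (a + b)*(c + d)\<close> satisfies\<close>
    moreover have "(s*t)^3 + 2*(s*t)^2 + 6*(s*t) + 1 = 0" using calculation r2 by algebra
    ultimately show ?thesis using r2 by algebra
  qed
  then show ?thesis
    unfolding pair cd p_def[symmetric] q_def[symmetric] s_def[symmetric] t_def[symmetric] half_ab half_cd .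
qed

lemma atLeastAtMost_1_4: "{1..4} = {1, 2, 3, 4::nat}"
  by auto

lemma
  assumes "tetranacci_roots lam"
  shows sum_tetranacci_roots: "lam 1 + lam 2 + lam 3 + lam 4 = 1"
    and prod_root_coeff:
      "root_coeff lam 1 * root_coeff lam 2 * (root_coeff lam 3 * root_coeff lam 4) = - 1 / 563"
proof -
  have bij: "bij_betw lam {1, 2, 3, 4} {x. x ^ 4 - x ^ 3 - x ^ 2 - x - 1 = 0}"
    using assms unfolding tetranacci_roots_def atLeastAtMost_1_4 .
  have root: "lam i ^ 4 - lam i ^ 3 - lam i ^ 2 - lam i - 1 = 0" if "i \<in> {1, 2, 3, 4}" for i
    using bij_betwE[OF bij] that by blast
  have distinct: "lam i \<noteq> lam j" if "i \<in> {1, 2, 3, 4}" "j \<in> {1, 2, 3, 4}" "i \<noteq> j" for i j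
    using inj_onD[OF bij_betw_imp_inj_on[OF bij]] that by blast
  have vieta:
    "lam 1 + lam 2 + lam 3 + lam 4 = 1"
    "lam 1 * lam 2 + lam 1 * lam 3 + lam 1 * lam 4 + lam 2 * lam 3 + lam 2 * lam 4 + lam 3 * lam 4 = - 1"
    "lam 1 * lam 2 * lam 3 + lam 1 * lam 2 * lam 4 + lam 1 * lam 3 * lam 4 + lam 2 * lam 3 * lam 4 = 1"
    "lam 1 * lam 2 * lam 3 * lam 4 = - 1"
    by (rule tetranacci_vieta; (rule root | rule distinct); simp)+
  show "lam 1 + lam 2 + lam 3 + lam 4 = 1" by (rule vieta(1))
  show "root_coeff lam 1 * root_coeff lam 2 * (root_coeff lam 3 * root_coeff lam 4) = - 1 / 563"
    unfolding root_coeff_def times_divide_times_eq tetranacci_discriminant[OF vieta] by simp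
qed

section \<open>Products of exponential generating functions\<close>

lemma egf_nth: "fact m * (fps_const c * egf a) $ m = c * a m"
  by (simp add: egf_def)

lemma fps_exp_eq_egf: "fps_exp c = egf (\<lambda>k. c ^ k)"
  by (simp add: egf_def fps_eq_iff)

lemma egf_mult: "egf a * egf b = egf (\<lambda>m. \<Sum>k=0..m. of_nat (m choose k) * a k * b (m - k))"
  by (auto simp: fps_eq_iff egf_def fps_mult_nth sum_divide_distrib binomial_fact intro!: sum.cong)

text \<open>
  Splitting off the first index turns a sum over tuples of given total into an iterated sum, which is
  how the coefficients of a product of several series arise from the product of two.
\<close>

lemma pairs_with_sum: "{(i, j). i + j = (m::nat)} = (\<lambda>i. (i, m - i)) ` {0..m}"
  by (auto simp: image_iff)

lemma triples_with_sum:
  "{(k1, k2, k3). k1 + k2 + k3 = (m::nat)} = Sigma {0..m} (\<lambda>k1. {(k2, k3). k2 + k3 = m - k1})"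
  by auto

lemma quadruples_with_sum:
  "{(k1, k2, k3, k4). k1 + k2 + k3 + k4 = (m::nat)} =
     Sigma {0..m} (\<lambda>k1. {(k2, k3, k4). k2 + k3 + k4 = m - k1})"
  by auto

lemma fps_mult3_nth:
  fixes f g h :: "'a::semiring_0 fps"
  shows "(f * (g * h)) $ m = (\<Sum>(k1, k2, k3) \<in> {(k1, k2, k3). k1 + k2 + k3 = m}. f $ k1 * (g $ k2 * h $ k3))"
proof -
  have pairs: "(g * h) $ j = (\<Sum>(k2, k3) \<in> {(k2, k3). k2 + k3 = j}. g $ k2 * h $ k3)" for j
    unfolding pairs_with_sum by (simp add: fps_mult_nth sum.reindex inj_on_def)
  show ?thesis
    unfolding triples_with_sum fps_mult_nth[of f] pairs sum_distrib_left
    by (subst sum.Sigma) (auto simp: pairs_with_sum intro!: sum.cong)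
qed

lemma fps_mult4_nth:
  fixes f g h w :: "'a::semiring_0 fps"
  shows "(f * (g * (h * w))) $ m =
     (\<Sum>(k1, k2, k3, k4) \<in> {(k1, k2, k3, k4). k1 + k2 + k3 + k4 = m}.
        f $ k1 * (g $ k2 * (h $ k3 * w $ k4)))"
  unfolding quadruples_with_sum fps_mult_nth[of f] fps_mult3_nth[of g] sum_distrib_left
  by (subst sum.Sigma) (auto simp: triples_with_sum pairs_with_sum intro!: sum.cong)

lemma egf_mult3:
  "egf a * (egf b * egf c) =
     egf (\<lambda>m. \<Sum>(k1, k2, k3) \<in> {(k1, k2, k3). k1 + k2 + k3 = m}.
                multinom m [k1, k2, k3] * a k1 * b k2 * c k3)"
  unfolding fps_eq_iff fps_mult3_nth
  by (auto simp: egf_def multinom_def sum_divide_distrib intro!: sum.cong)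

lemma egf_mult4:
  "egf a * (egf b * (egf c * egf d)) =
     egf (\<lambda>m. \<Sum>(k1, k2, k3, k4) \<in> {(k1, k2, k3, k4). k1 + k2 + k3 + k4 = m}.
                multinom m [k1, k2, k3, k4] * a k1 * b k2 * c k3 * d k4)"
  unfolding fps_eq_iff fps_mult4_nth
  by (auto simp: egf_def multinom_def sum_divide_distrib intro!: sum.cong)

section \<open>The sequences as symmetric functions of the exponential terms\<close>

definition exp_term :: "(nat \<Rightarrow> complex) \<Rightarrow> nat \<Rightarrow> nat \<Rightarrow> complex fps" where
  "exp_term lam n i = fps_const (root_coeff lam i ^ n) * fps_exp (lam i)"

text \<open>
  Raising \<open>c^n e^(\<lambda> x)\<close> to the power \<open>r\<close> turns \<open>n\<close> into \<open>r n\<close> and \<open>x\<close> into \<open>r x\<close>; the latter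
  multiplies the coefficient of index \<open>k\<close> by \<open>r^k\<close>.
\<close>

lemma power_sum_eq_egf:
  assumes "tetranacci_normal_form (power_gf lam (r * n)) a s"
  shows "exp_term lam n 1 ^ r + exp_term lam n 2 ^ r + exp_term lam n 3 ^ r + exp_term lam n 4 ^ r =
    fps_const (1 / of_rat a) * egf (\<lambda>k. of_nat r ^ k * of_int (s k))"
proof (rule fps_ext)
  fix k
  have "power_gf lam (r * n) $ k = (fps_const (1 / of_rat a) * egf (\<lambda>k. of_int (s k))) $ k"
    using assms by (simp add: tetranacci_normal_form_def)
  then have "of_nat r ^ k * power_gf lam (r * n) $ k = of_nat r ^ k * of_int (s k) / (of_rat a * fact k)"
    by (simp add: egf_def)
  moreover have "(exp_term lam n 1 ^ r + exp_term lam n 2 ^ r + exp_term lam n 3 ^ r + exp_term lam n 4 ^ r) $ k =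
      of_nat r ^ k * power_gf lam (r * n) $ k"
    unfolding exp_term_def power_gf_def atLeastAtMost_1_4
    by (simp add: power_mult_distrib fps_exp_power_mult
        power_mult[symmetric] algebra_simps)
  ultimately show "(exp_term lam n 1 ^ r + exp_term lam n 2 ^ r + exp_term lam n 3 ^ r + exp_term lam n 4 ^ r) $ k =
      (fps_const (1 / of_rat a) * egf (\<lambda>k. of_nat r ^ k * of_int (s k))) $ k"
    by (simp add: egf_def)
qed

text \<open>
  Since the roots add up to \<open>1\<close>, the product of three of the exponentials is
  \<open>e^((1 - \<lambda>\<^sub>i) x) = e^x e^(- \<lambda>\<^sub>i x)\<close>, where \<open>\<lambda>\<^sub>i\<close> is the remaining root.
\<close>

lemma triple_products_eq_egf:
  assumes roots: "tetranacci_roots lam"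
    and nf: "tetranacci_normal_form (coproduct_gf lam n) a s"
  shows "exp_term lam n 1 * exp_term lam n 2 * exp_term lam n 3
       + exp_term lam n 1 * exp_term lam n 2 * exp_term lam n 4
       + exp_term lam n 1 * exp_term lam n 3 * exp_term lam n 4
       + exp_term lam n 2 * exp_term lam n 3 * exp_term lam n 4 =
    fps_const (1 / of_rat a) * egf (\<lambda>k. (- 1) ^ k * of_int (s k)) * egf (\<lambda>_. 1)"
proof -
  let ?c = "\<lambda>i. root_coeff lam i ^ n"
  let ?reflected = "fps_const (?c 1 * ?c 2 * ?c 3) * fps_exp (- lam 4)
      + fps_const (?c 1 * ?c 2 * ?c 4) * fps_exp (- lam 3)
      + fps_const (?c 1 * ?c 3 * ?c 4) * fps_exp (- lam 2)
      + fps_const (?c 2 * ?c 3 * ?c 4) * fps_exp (- lam 1)"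
  have sum: "lam 1 + lam 2 + lam 3 + lam 4 = 1"
    by (rule sum_tetranacci_roots[OF roots])
  have complement: "fps_exp (lam i) * fps_exp (lam j) * fps_exp (lam l) = fps_exp (- lam k) * fps_exp 1"
    if "lam i + lam j + lam l = 1 - lam k" for i j k l
    unfolding fps_exp_add_mult[symmetric] that by simp
  have coproduct: "coproduct_gf lam n = fps_const (?c 2 * ?c 3 * ?c 4) * fps_exp (lam 1)
      + fps_const (?c 1 * ?c 3 * ?c 4) * fps_exp (lam 2)
      + fps_const (?c 1 * ?c 2 * ?c 4) * fps_exp (lam 3)
      + fps_const (?c 1 * ?c 2 * ?c 3) * fps_exp (lam 4)"
    unfolding coproduct_gf_def atLeastAtMost_1_4
    by (simp add: insert_Diff_if mult.assoc add.assoc del: fps_const_mult)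
  have reflected: "?reflected = fps_const (1 / of_rat a) * egf (\<lambda>k. (- 1) ^ k * of_int (s k))"
  proof (rule fps_ext)
    fix k
    have "coproduct_gf lam n $ k = (fps_const (1 / of_rat a) * egf (\<lambda>k. of_int (s k))) $ k"
      using nf by (simp add: tetranacci_normal_form_def)
    then have "(- 1) ^ k * coproduct_gf lam n $ k = (- 1) ^ k * of_int (s k) / (of_rat a * fact k)"
      by (simp add: egf_def)
    moreover have "?reflected $ k = (- 1) ^ k * coproduct_gf lam n $ k"
    proof -
      have sign: "fps_exp (- lam i) $ k = (- 1) ^ k * fps_exp (lam i) $ k" for i
        by (simp add: power_minus[of "lam i"])
      show ?thesis
        unfolding coproduct fps_add_nth fps_mult_left_const_nth sign by (simp only: algebra_simps)
    qed
    ultimately show "?reflected $ k = (fps_const (1 / of_rat a) * egf (\<lambda>k. (- 1) ^ k * of_int (s k))) $ k"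
      by (simp add: egf_def)
  qed
  have product: "exp_term lam n i * exp_term lam n j * exp_term lam n l =
      fps_const (?c i * ?c j * ?c l) * fps_exp (- lam k) * fps_exp 1"
    if "lam i + lam j + lam l = 1 - lam k" for i j k l
  proof -
    have "exp_term lam n i * exp_term lam n j * exp_term lam n l =
        fps_const (?c i * ?c j * ?c l) * (fps_exp (lam i) * fps_exp (lam j) * fps_exp (lam l))"
      unfolding exp_term_def fps_const_mult[symmetric] by (simp only: mult_ac)
    then show ?thesis unfolding complement[OF that] by (simp only: mult.assoc)
  qed
  have "exp_term lam n 1 * exp_term lam n 2 * exp_term lam n 3
       + exp_term lam n 1 * exp_term lam n 2 * exp_term lam n 4
       + exp_term lam n 1 * exp_term lam n 3 * exp_term lam n 4
       + exp_term lam n 2 * exp_term lam n 3 * exp_term lam n 4 = ?reflected * fps_exp 1"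
    unfolding distrib_right
    by (intro arg_cong2[where f = "(+)"] product) (use sum in \<open>simp_all add: algebra_simps\<close>)
  also have "fps_exp 1 = egf (\<lambda>_. 1)"
    by (simp add: fps_exp_eq_egf)
  finally show ?thesis unfolding reflected .
qed

lemma prod_exp_terms:
  assumes "tetranacci_roots lam"
  shows "exp_term lam n 1 * exp_term lam n 2 * exp_term lam n 3 * exp_term lam n 4 =
    fps_const ((- 1 / 563) ^ n) * egf (\<lambda>_. 1)"
proof -
  have "exp_term lam n 1 * exp_term lam n 2 * exp_term lam n 3 * exp_term lam n 4 =
      fps_const ((root_coeff lam 1 * root_coeff lam 2 * (root_coeff lam 3 * root_coeff lam 4)) ^ n) *
      fps_exp (lam 1 + lam 2 + lam 3 + lam 4)"
    unfolding exp_term_def power_mult_distrib fps_const_mult[symmetric] fps_exp_add_mult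
    by (simp only: mult_ac)
  then show ?thesis
    by (simp only: prod_root_coeff[OF assms] sum_tetranacci_roots[OF assms] fps_exp_eq_egf power_one)
qed

lemma t2_gf_eq_monomial_symmetric:
  defines "a \<equiv> exp_term"
  shows "t2_gf lam n =
      a lam n 1 * a lam n 2 * a lam n 3 * (a lam n 1 + a lam n 2 + a lam n 3)
    + a lam n 1 * a lam n 2 * a lam n 4 * (a lam n 1 + a lam n 2 + a lam n 4)
    + a lam n 1 * a lam n 3 * a lam n 4 * (a lam n 1 + a lam n 3 + a lam n 4)
    + a lam n 2 * a lam n 3 * a lam n 4 * (a lam n 2 + a lam n 3 + a lam n 4)"
proof -
  have index: "{(i, j, l). 1 \<le> i \<and> i < j \<and> j < l \<and> l \<le> (4::nat)} =
      {(1, 2, 3), (1, 2, 4), (1, 3, 4), (2, 3, 4)}"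
    by auto
  have weight: "fps_const (root_coeff lam i ^ n * root_coeff lam j ^ n * root_coeff lam l ^ n) *
      fps_exp (lam i + lam j + lam l) = a lam n i * a lam n j * a lam n l" for i j l
    unfolding a_def exp_term_def fps_const_mult[symmetric] fps_exp_add_mult by (simp only: mult_ac)
  show ?thesis
    unfolding t2_gf_def index weight by (simp add: a_def exp_term_def add.assoc)
qed

section \<open>The identity between symmetric polynomials\<close>

text \<open>
  In terms of monomial symmetric functions, the relations for \<open>A\<close>, \<open>C\<close>, \<open>F\<close>, \<open>I\<close>, \<open>B\<close> say in turn that
  the coefficients of \<open>m\<^sub>4\<close>, \<open>m\<^sub>3\<^sub>1\<close>, \<open>m\<^sub>2\<^sub>2\<close>, \<open>m\<^sub>2\<^sub>1\<^sub>1\<close>, \<open>m\<^sub>1\<^sub>1\<^sub>1\<^sub>1\<close> agree on both sides.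
\<close>

lemma quartic_symmetric_identity:
  fixes a b c d D E G H J :: "'a::comm_ring_1"
  defines "p1 \<equiv> a + b + c + d" and "p2 \<equiv> a^2 + b^2 + c^2 + d^2"
    and "p3 \<equiv> a^3 + b^3 + c^3 + d^3" and "p4 \<equiv> a^4 + b^4 + c^4 + d^4"
    and "e2 \<equiv> a*b + a*c + a*d + b*c + b*d + c*d"
    and "e3 \<equiv> a*b*c + a*b*d + a*c*d + b*c*d" and "e4 \<equiv> a*b*c*d"
  assumes A: "A = - D + E + G + H - 3"
    and B: "B = 12 * D + 12 * G - 4 * J - 12"
    and C: "C = - E - 2 * G - H + 4"
    and F: "F = - 2 * D - 2 * G - 2 * H + 6"
    and I: "I = 4 * D - E + 2 * G - H - J"
  shows "I * (a*b*c * (a+b+c) + a*b*d * (a+b+d) + a*c*d * (a+c+d) + b*c*d * (b+c+d)) =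
    p1^4 - A * p4 - B * e4 - C * (p1 * p3) - D * p2^2 - E * (e2 * p2) - F * e2^2
      - G * (p2 * p1^2) - H * (e2 * p1^2) - J * (e3 * p1)"
proof -
  define m31 where "m31 = a^3 * (b+c+d) + b^3 * (a+c+d) + c^3 * (a+b+d) + d^3 * (a+b+c)"
  define m22 where "m22 = a^2*b^2 + a^2*c^2 + a^2*d^2 + b^2*c^2 + b^2*d^2 + c^2*d^2"
  define m211 where
    "m211 = a*b*c * (a+b+c) + a*b*d * (a+b+d) + a*c*d * (a+c+d) + b*c*d * (b+c+d)"
  note defs = p1_def p2_def p3_def p4_def e2_def e3_def e4_def m31_def m22_def m211_def
  have "p1^4 = p4 + 4 * m31 + 6 * m22 + 12 * m211 + 24 * e4"
    unfolding defs by (simp add: algebra_simps power2_eq_square power3_eq_cube power4_eq_xxxx)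
  moreover have "p1 * p3 = p4 + m31"
    unfolding defs by (simp add: algebra_simps power2_eq_square power3_eq_cube power4_eq_xxxx)
  moreover have "p2^2 = p4 + 2 * m22"
    unfolding defs by (simp add: algebra_simps power2_eq_square power3_eq_cube power4_eq_xxxx)
  moreover have "e2 * p2 = m31 + m211"
    unfolding defs by (simp add: algebra_simps power2_eq_square power3_eq_cube power4_eq_xxxx)
  moreover have "e2^2 = m22 + 2 * m211 + 6 * e4"
    unfolding defs by (simp add: algebra_simps power2_eq_square power3_eq_cube power4_eq_xxxx)
  moreover have "p2 * p1^2 = p4 + 2 * m22 + 2 * m31 + 2 * m211"
    unfolding defs by (simp add: algebra_simps power2_eq_square power3_eq_cube power4_eq_xxxx)
  moreover have "e2 * p1^2 = m31 + 2 * m22 + 5 * m211 + 12 * e4"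
    unfolding defs by (simp add: algebra_simps power2_eq_square power3_eq_cube power4_eq_xxxx)
  moreover have "e3 * p1 = m211 + 4 * e4"
    unfolding defs by (simp add: algebra_simps power2_eq_square power3_eq_cube power4_eq_xxxx)
  ultimately show ?thesis
    unfolding m211_def[symmetric] A B C F I by (simp only:) (simp add: algebra_simps)
qed

theorem theorem15:
  fixes lam :: "nat \<Rightarrow> complex"
    and A1 A2 :: "nat \<Rightarrow> rat"
    and U V :: "nat \<Rightarrow> nat \<Rightarrow> int"
    and A B C D E F G H I J :: complex
    and m n :: nat
  assumes roots: "tetranacci_roots lam"
    and U: "\<And>r. r \<ge> 1 \<Longrightarrow> tetranacci_normal_form (power_gf lam r) (A1 r) (U r)"
    and V: "\<And>r. r \<ge> 1 \<Longrightarrow> tetranacci_normal_form (coproduct_gf lam r) (A2 r) (V r)"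
    and A: "A = - D + E + G + H - 3"
    and B: "B = 12 * D + 12 * G - 4 * J - 12"
    and C: "C = - E - 2 * G - H + 4"
    and F: "F = - 2 * D - 2 * G - 2 * H + 6"
    and I: "I = 4 * D - E + 2 * G - H - J"
    and I_nonzero: "I \<noteq> 0"
    and n: "n \<ge> 1"
  shows "I * t2 lam n m =
      1 / of_rat (A1 n) ^ 4 *
        (\<Sum>(k1, k2, k3, k4) \<in> {(k1, k2, k3, k4). k1 + k2 + k3 + k4 = m}.
           multinom m [k1, k2, k3, k4] *
           of_int (U n k1) * of_int (U n k2) * of_int (U n k3) * of_int (U n k4))
      - A / of_rat (A1 (4 * n)) * 4 ^ m * of_int (U (4 * n) m)
      - B * (- 1 / 563) ^ n
      - C / (of_rat (A1 (3 * n)) * of_rat (A1 n)) *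
        (\<Sum>k=0..m. of_nat (m choose k) * 3 ^ (m - k) *
           of_int (U (3 * n) (m - k)) * of_int (U n k))
      - D / of_rat (A1 (2 * n)) ^ 2 *
        (\<Sum>k=0..m. of_nat (m choose k) * 2 ^ m *
           of_int (U (2 * n) k) * of_int (U (2 * n) (m - k)))
      - E / of_rat (A1 (2 * n)) *
        (\<Sum>k=0..m. of_nat (m choose k) * 2 ^ (m - k) *
           of_int (U (2 * n) (m - k)) * t1 A1 U n k)
      - F * (\<Sum>k=0..m. of_nat (m choose k) * t1 A1 U n k * t1 A1 U n (m - k))
      - G / (of_rat (A1 (2 * n)) * of_rat (A1 n) ^ 2) *
        (\<Sum>(k1, k2, k3) \<in> {(k1, k2, k3). k1 + k2 + k3 = m}.
           multinom m [k1, k2, k3] * 2 ^ k1 *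
           of_int (U (2 * n) k1) * of_int (U n k2) * of_int (U n k3))
      - H / of_rat (A1 n) ^ 2 *
        (\<Sum>(k1, k2, k3) \<in> {(k1, k2, k3). k1 + k2 + k3 = m}.
           multinom m [k1, k2, k3] * t1 A1 U n k1 *
           of_int (U n k2) * of_int (U n k3))
      - J / (of_rat (A2 n) * of_rat (A1 n)) *
        (\<Sum>(k1, k2, k3) \<in> {(k1, k2, k3). k1 + k2 + k3 = m}.
           multinom m [k1, k2, k3] * (- 1) ^ k1 *
           of_int (V n k1) * of_int (U n k2))"
proof -
  define x1 x2 x3 x4 where x_defs:
    "x1 = exp_term lam n 1" "x2 = exp_term lam n 2" "x3 = exp_term lam n 3" "x4 = exp_term lam n 4"
  define p where "p r = x1 ^ r + x2 ^ r + x3 ^ r + x4 ^ r" for r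
  define e2 where "e2 = x1 * x2 + x1 * x3 + x1 * x4 + x2 * x3 + x2 * x4 + x3 * x4"
  define e3 where "e3 = x1 * x2 * x3 + x1 * x2 * x4 + x1 * x3 * x4 + x2 * x3 * x4"
  define e4 where "e4 = x1 * x2 * x3 * x4"

  let ?u = "\<lambda>r. 1 / of_rat (A1 (r * n)) :: complex"
  let ?U = "\<lambda>r k. of_nat r ^ k * of_int (U (r * n) k) :: complex"
  have p_eq: "p r = fps_const (?u r) * egf (?U r)" if "r \<ge> 1" for r
    unfolding p_def x_defs using that n by (intro power_sum_eq_egf U) simp
  have p1: "p 1 = fps_const (1 / of_rat (A1 n)) * egf (\<lambda>k. of_int (U n k))"
    using p_eq[of 1] by simp
  have p2: "p 2 = fps_const (1 / of_rat (A1 (2 * n))) * egf (\<lambda>k. 2 ^ k * of_int (U (2 * n) k))"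
    using p_eq[of 2] by simp
  have p3: "p 3 = fps_const (1 / of_rat (A1 (3 * n))) * egf (\<lambda>k. 3 ^ k * of_int (U (3 * n) k))"
    using p_eq[of 3] by simp
  have p4: "p 4 = fps_const (1 / of_rat (A1 (4 * n))) * egf (\<lambda>k. 4 ^ k * of_int (U (4 * n) k))"
    using p_eq[of 4] by simp
  have e2: "e2 = egf (t1 A1 U n)"
  proof -
    have "2 * e2 = p 1 * p 1 - p 2"
      unfolding e2_def p_def by algebra
    also have "p 1 * p 1 = fps_const (1 / of_rat (A1 n) ^ 2) *
        (egf (\<lambda>k. of_int (U n k)) * egf (\<lambda>k. of_int (U n k)))"
      unfolding p1 by (simp add: divide_inverse power2_eq_square fps_const_mult[symmetric] mult_ac del: fps_const_mult)
    also have "\<dots> - p 2 = 2 * egf (t1 A1 U n)"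
      unfolding p2 egf_mult
      by (simp add: fps_eq_iff egf_def t1_def numeral_fps_const field_simps)
    finally show ?thesis by simp
  qed
  have e3: "e3 = fps_const (1 / of_rat (A2 n)) * egf (\<lambda>k. (- 1) ^ k * of_int (V n k)) * egf (\<lambda>_. 1)"
    unfolding e3_def x_defs by (intro triple_products_eq_egf roots V n)
  have e4: "e4 = fps_const ((- 1 / 563) ^ n) * egf (\<lambda>_. 1)"
    unfolding e4_def x_defs by (rule prod_exp_terms[OF roots])

  \<comment> \<open>The relations between the constants are transferred to constant power series, because the
    symmetric identity is used in the ring of power series.\<close>
  have "fps_const A = - fps_const D + fps_const E + fps_const G + fps_const H - 3"
    "fps_const B = 12 * fps_const D + 12 * fps_const G - 4 * fps_const J - 12"
    "fps_const C = - fps_const E - 2 * fps_const G - fps_const H + 4"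
    "fps_const F = - 2 * fps_const D - 2 * fps_const G - 2 * fps_const H + 6"
    "fps_const I = 4 * fps_const D - fps_const E + 2 * fps_const G - fps_const H - fps_const J"
    by (simp_all add: A B C F I numeral_fps_const)
  note identity = quartic_symmetric_identity[OF this, of x1 x2 x3 x4]
  have "fps_const I * t2_gf lam n =
      p 1 ^ 4 - fps_const A * p 4 - fps_const B * e4 - fps_const C * (p 1 * p 3)
      - fps_const D * p 2 ^ 2 - fps_const E * (e2 * p 2) - fps_const F * e2 ^ 2
      - fps_const G * (p 2 * p 1 ^ 2) - fps_const H * (e2 * p 1 ^ 2) - fps_const J * (e3 * p 1)"
    unfolding t2_gf_eq_monomial_symmetric x_defs[symmetric] identity p_def e2_def e3_def e4_def
    by simp
  then have "fact m * (fps_const I * t2_gf lam n) $ m = fact m *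
      (p 1 ^ 4 - fps_const A * p 4 - fps_const B * e4 - fps_const C * (p 1 * p 3)
      - fps_const D * p 2 ^ 2 - fps_const E * (e2 * p 2) - fps_const F * e2 ^ 2
      - fps_const G * (p 2 * p 1 ^ 2) - fps_const H * (e2 * p 1 ^ 2) - fps_const J * (e3 * p 1)) $ m"
    by (rule arg_cong)
  then have split: "I * t2 lam n m =
      fact m * p 1 ^ 4 $ m - A * (fact m * p 4 $ m) - B * (fact m * e4 $ m)
      - C * (fact m * (p 1 * p 3) $ m) - D * (fact m * p 2 ^ 2 $ m)
      - E * (fact m * (e2 * p 2) $ m) - F * (fact m * e2 ^ 2 $ m)
      - G * (fact m * (p 2 * p 1 ^ 2) $ m) - H * (fact m * (e2 * p 1 ^ 2) $ m)
      - J * (fact m * (e3 * p 1) $ m)"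
    by (simp only: t2_def fps_sub_nth fps_mult_left_const_nth right_diff_distrib
        mult.left_commute[of "fact m"])

  \<comment> \<open>In every product the constant factors are collected in front, so that \<open>egf_nth\<close> reads off
    the coefficient of \<open>x^m / m!\<close>.\<close>
  note collect = power2_eq_square fps_const_mult[symmetric] mult_ac
  have "p 1 ^ 4 = fps_const (1 / of_rat (A1 n) ^ 4) *
      (egf (\<lambda>k. of_int (U n k)) * (egf (\<lambda>k. of_int (U n k)) *
        (egf (\<lambda>k. of_int (U n k)) * egf (\<lambda>k. of_int (U n k)))))"
    unfolding p1 power_mult_distrib by (simp add: power4_eq_xxxx mult.assoc)
  then have c1: "fact m * p 1 ^ 4 $ m = 1 / of_rat (A1 n) ^ 4 *
        (\<Sum>(k1, k2, k3, k4) \<in> {(k1, k2, k3, k4). k1 + k2 + k3 + k4 = m}.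
           multinom m [k1, k2, k3, k4] *
           of_int (U n k1) * of_int (U n k2) * of_int (U n k3) * of_int (U n k4))"
    by (simp only: egf_mult4 egf_nth)
  have cA: "fact m * p 4 $ m = 1 / of_rat (A1 (4 * n)) * (4 ^ m * of_int (U (4 * n) m))"
    unfolding p4 egf_nth ..
  have cB: "fact m * e4 $ m = (- 1 / 563) ^ n"
    unfolding e4 egf_nth by simp
  have "p 1 * p 3 = fps_const (1 / (of_rat (A1 (3 * n)) * of_rat (A1 n))) *
      (egf (\<lambda>k. of_int (U n k)) * egf (\<lambda>k. 3 ^ k * of_int (U (3 * n) k)))"
    unfolding p1 p3 by (simp add: divide_inverse collect del: fps_const_mult)
  then have cC: "fact m * (p 1 * p 3) $ m = 1 / (of_rat (A1 (3 * n)) * of_rat (A1 n)) *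
        (\<Sum>k=0..m. of_nat (m choose k) * 3 ^ (m - k) *
           of_int (U (3 * n) (m - k)) * of_int (U n k))"
    by (simp only: egf_mult egf_nth) (simp add: mult_ac)
  have "p 2 ^ 2 = fps_const (1 / of_rat (A1 (2 * n)) ^ 2) *
      (egf (\<lambda>k. 2 ^ k * of_int (U (2 * n) k)) * egf (\<lambda>k. 2 ^ k * of_int (U (2 * n) k)))"
    unfolding p2 power_mult_distrib by (simp add: power2_eq_square)
  moreover have "(\<Sum>k=0..m. of_nat (m choose k) * (2 ^ k * of_int (U (2 * n) k)) *
        (2 ^ (m - k) * of_int (U (2 * n) (m - k)))) =
      (\<Sum>k=0..m. of_nat (m choose k) * 2 ^ m *
        of_int (U (2 * n) k) * of_int (U (2 * n) (m - k)) :: complex)"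
  proof (rule sum.cong[OF refl])
    fix k assume "k \<in> {0..m}"
    then have "(2::complex) ^ m = 2 ^ k * 2 ^ (m - k)"
      by (simp add: power_add[symmetric])
    then show "of_nat (m choose k) * (2 ^ k * of_int (U (2 * n) k)) *
        (2 ^ (m - k) * of_int (U (2 * n) (m - k))) =
      (of_nat (m choose k) * 2 ^ m * of_int (U (2 * n) k) * of_int (U (2 * n) (m - k)) :: complex)"
      by (simp only: mult_ac)
  qed
  ultimately have cD: "fact m * p 2 ^ 2 $ m = 1 / of_rat (A1 (2 * n)) ^ 2 *
        (\<Sum>k=0..m. of_nat (m choose k) * 2 ^ m *
           of_int (U (2 * n) k) * of_int (U (2 * n) (m - k)))"
    by (simp only: egf_mult egf_nth)
  have "e2 * p 2 = fps_const (1 / of_rat (A1 (2 * n))) *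
      (egf (t1 A1 U n) * egf (\<lambda>k. 2 ^ k * of_int (U (2 * n) k)))"
    unfolding e2 p2 by (simp only: mult_ac)
  then have cE: "fact m * (e2 * p 2) $ m = 1 / of_rat (A1 (2 * n)) *
        (\<Sum>k=0..m. of_nat (m choose k) * 2 ^ (m - k) *
           of_int (U (2 * n) (m - k)) * t1 A1 U n k)"
    by (simp only: egf_mult egf_nth) (simp add: mult_ac)
  have "e2 ^ 2 = fps_const 1 * (egf (t1 A1 U n) * egf (t1 A1 U n))"
    unfolding e2 by (simp add: power2_eq_square)
  then have cF: "fact m * e2 ^ 2 $ m =
      (\<Sum>k=0..m. of_nat (m choose k) * t1 A1 U n k * t1 A1 U n (m - k))"
    by (simp only: egf_mult egf_nth mult_1)
  have "p 2 * p 1 ^ 2 = fps_const (1 / (of_rat (A1 (2 * n)) * of_rat (A1 n) ^ 2)) *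
      (egf (\<lambda>k. 2 ^ k * of_int (U (2 * n) k)) *
        (egf (\<lambda>k. of_int (U n k)) * egf (\<lambda>k. of_int (U n k))))"
    unfolding p1 p2 by (simp add: divide_inverse collect del: fps_const_mult)
  then have cG: "fact m * (p 2 * p 1 ^ 2) $ m = 1 / (of_rat (A1 (2 * n)) * of_rat (A1 n) ^ 2) *
        (\<Sum>(k1, k2, k3) \<in> {(k1, k2, k3). k1 + k2 + k3 = m}.
           multinom m [k1, k2, k3] * 2 ^ k1 *
           of_int (U (2 * n) k1) * of_int (U n k2) * of_int (U n k3))"
    by (simp only: egf_mult3 egf_nth mult.assoc)
  have "e2 * p 1 ^ 2 = fps_const (1 / of_rat (A1 n) ^ 2) *
      (egf (t1 A1 U n) * (egf (\<lambda>k. of_int (U n k)) * egf (\<lambda>k. of_int (U n k))))"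
    unfolding e2 p1 by (simp add: divide_inverse collect del: fps_const_mult)
  then have cH: "fact m * (e2 * p 1 ^ 2) $ m = 1 / of_rat (A1 n) ^ 2 *
        (\<Sum>(k1, k2, k3) \<in> {(k1, k2, k3). k1 + k2 + k3 = m}.
           multinom m [k1, k2, k3] * t1 A1 U n k1 *
           of_int (U n k2) * of_int (U n k3))"
    by (simp only: egf_mult3 egf_nth)
  have "e3 * p 1 = fps_const (1 / (of_rat (A2 n) * of_rat (A1 n))) *
      (egf (\<lambda>k. (- 1) ^ k * of_int (V n k)) * (egf (\<lambda>k. of_int (U n k)) * egf (\<lambda>_. 1)))"
    unfolding e3 p1 by (simp add: divide_inverse collect del: fps_const_mult)
  then have cJ: "fact m * (e3 * p 1) $ m = 1 / (of_rat (A2 n) * of_rat (A1 n)) *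
        (\<Sum>(k1, k2, k3) \<in> {(k1, k2, k3). k1 + k2 + k3 = m}.
           multinom m [k1, k2, k3] * (- 1) ^ k1 *
           of_int (V n k1) * of_int (U n k2))"
    by (simp only: egf_mult3 egf_nth mult.assoc mult_1_right)
  show ?thesis
    unfolding split c1 cA cB cC cD cE cF cG cH cJ
    by (simp only: divide_inverse mult_1_left mult.assoc)
qed

end
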